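(* Let $\varphi\in\mathsf{FO}(\sim,\mathcal D)$, let $\vec x$ be a tuple of variables containing all free variables of $\varphi$, let $\mathcal A$ be a finite structure, and let $T$ be a finite team in $\mathcal A$ with domain $Y\supseteq\vec x$. Then $(\mathcal A,T)\vDash\varphi$ if and only if $\mathcal A\vDash\eta^{\vec x}_\varphi(\vec x\langle T\rangle)$.
   Context: Teams. A team $T$ in a $\tau$-structure $\mathcal A$ with domain $X$ (a set of variables) is a set of assignments $s\colon X\to \mathrm{dom}\,\mathcal A$. For a tuple $\vec t$ of terms with variables in $X$, $\vec t\langle s\rangle$ is its value under $s$ and $\vec t\langle T\rangle=\{\vec t\langle s\rangle\mid s\in T\}$. For $f\colon T\to\mathfrak P(\mathrm{dom}\,\mathcal A)\setminus\{\emptyset\}$ let $T^x_f=\{s^x_a\mid s\in T, a\in f(s)\}$, where $s^x_a$ maps $x$ to $a$ and agrees with $s$ on the other variables; $T^x_A$ is the case $f(s)=A$ constant. A tuple $\vec x$ is identified with its underlying set where convenient. Dependencies. A $k$-ary dependency is a first-order sentence $\delta$ (equality allowed) over a vocabulary $\{P\}$ with $P$ a $k$-ary predicate. $\mathcal D=\{\delta_1,\delta_2,\ldots\}$ is a (possibly infinite) set of dependencies; for $k$-ary $\delta_i\in\mathcal D$ and a $k$-tuple $\vec t$ of $\tau$-terms there is a dependency atom $A_i\vec t$. Logic. $\mathsf{FO}(\sim,\mathcal D)$ (over $\tau$) has the formulas $\varphi ::= \alpha \mid A_i\vec t\mid {\sim}\varphi \mid \varphi\wedge\varphi \mid \varphi\vee\varphi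 \mid \exists x\,\varphi \mid \forall x\,\varphi$ with $\alpha$ an ordinary first-order $\tau$-formula. For a team $T$ whose domain contains the free variables of $\varphi$: if $\varphi\in\mathsf{FO}$, $(\mathcal A,T)\vDash\varphi$ iff $(\mathcal A,s)\vDash\varphi$ (Tarski) for all $s\in T$; otherwise $(\mathcal A,T)\vDash A_i\vec t$ iff $\delta_i$ holds in the structure with domain $\mathrm{dom}\,\mathcal A$ and $P$ interpreted as $\vec t\langle T\rangle$; $(\mathcal A,T)\vDash{\sim}\psi$ iff $(\mathcal A,T)\nvDash\psi$; $\wedge$ is conjunction; $(\mathcal A,T)\vDash\psi\vee\theta$ iff there are $S,U\subseteq T$ with $T=S\cup U$, $(\mathcal A,S)\vDash\psi$, $(\mathcal A,U)\vDash\theta$; $(\mathcal A,T)\vDash\exists x\,\psi$ iff $(\mathcal A,T^x_f)\vDash\psi$ for some $f\colon T\to\mathfrak P(\mathrm{dom}\,\mathcal A)\setminus\{\emptyset\}$; $(\mathcal A,T)\vDash\forall x\,\psi$ iff $(\mathcal A,T^x_{\mathrm{dom}\,\mathcal A})\vDash\psi$. Translation to second-order logic (with equality). For $\vec x=(x_1,\ldots,x_n)$, a variable $y$, let $\vec x;y$ be $\vec x$ if $y\in\{x_1,\ldots,x_n\}$ and $(x_1,\ldots,x_n,y)$ otherwise. For $\varphi\in\mathsf{FO}(\sim,\mathcal D)$ with free variables in $\vec x$ and an $n$-ary predicate variable $R$, the second-order formula $\eta^{\vec x}_\varphi(R)$ is defined recursively ($S,U$ are fresh predicate variables of the appropriate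 arity): - $\varphi$ first-order: $\forall\vec x\,(R\vec x\to\varphi)$; - $\varphi=A_i\vec t$ with $\delta_i$ $k$-ary: $\exists S\,\big[\forall\vec z\,(S\vec z\leftrightarrow\exists\vec x\,(R\vec x\wedge\vec t=\vec z))\wedge\delta_i(S)\big]$, where $\vec z=(z_1,\ldots,z_k)$ are pairwise distinct variables not in $\vec x$ and $\delta_i(S)$ is $\delta_i$ with $P$ replaced by $S$; - $\varphi={\sim}\psi$: $\neg\eta^{\vec x}_\psi(R)$; - $\varphi=\psi\wedge\theta$: $\eta^{\vec x}_\psi(R)\wedge\eta^{\vec x}_\theta(R)$; - $\varphi=\psi\vee\theta$: $\exists S\,\exists U\,\big[\forall\vec x\,(R\vec x\leftrightarrow(S\vec x\vee U\vec x))\wedge\eta^{\vec x}_\psi(S)\wedge\eta^{\vec x}_\theta(U)\big]$; - $\varphi=\exists y\,\psi$: $\exists S\,\big[\forall\vec x\,((\exists y\,R\vec x)\leftrightarrow(\exists y\,S\,\vec x;y))\wedge\eta^{\vec x;y}_\psi(S)\big]$; - $\varphi=\forall y\,\psi$: $\exists S\,\big[\forall\vec x\,((\exists y\,R\vec x)\leftrightarrow(\exists y\,S\,\vec x;y))\wedge\eta^{\vec x;y}_\psi(S)\wedge\forall\vec x\,(R\vec x\to\forall y\,S\,\vec x;y)\big]$. The first clause takes precedence when $\varphi$ is first-order. $\mathcal A\vDash\eta^{\vec x}_\varphi(Q)$ means that $\eta^{\vec x}_\varphi(R)$ holds in $\mathcal A$ with $R$ interpreted as $Q$. *)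

theory Defs
  imports Main
begin

text \<open>First-order variables are natural numbers.\<close>

datatype 'f tm = Var nat | Fn 'f "'f tm list"

record ('f, 'p) vocabulary =
  fsyms :: "'f set"
  fun_arity :: "'f \<Rightarrow> nat"
  psyms :: "'p set"
  pred_arity :: "'p \<Rightarrow> nat"

record ('a, 'f, 'p) struct =
  univ :: "'a set"
  fn :: "'f \<Rightarrow> 'a list \<Rightarrow> 'a"
  rel :: "'p \<Rightarrow> 'a list set"

definition tuples :: "nat \<Rightarrow> 'a set \<Rightarrow> 'a list set" where
  "tuples n X = {as. length as = n \<and> set as \<subseteq> X}"

definition is_structure :: "('f, 'p) vocabulary \<Rightarrow> ('a, 'f, 'p) struct \<Rightarrow> bool" where
  "is_structure \<tau> A \<longleftrightarrow> univ A \<noteq> {} \<and>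
     (\<forall>f\<in>fsyms \<tau>. \<forall>as\<in>tuples (fun_arity \<tau> f) (univ A). fn A f as \<in> univ A) \<and>
     (\<forall>p\<in>psyms \<tau>. rel A p \<subseteq> tuples (pred_arity \<tau> p) (univ A))"

text \<open>An assignment with domain \<open>X\<close> is a partial function \<open>s\<close> with \<open>dom s = X\<close>. Outside of
  \<open>dom s\<close> the value of a variable is unspecified.\<close>

type_synonym 'a assignment = "nat \<Rightarrow> 'a option"

primrec val :: "('a, 'f, 'p) struct \<Rightarrow> 'a assignment \<Rightarrow> 'f tm \<Rightarrow> 'a" where
  "val A s (Var x) = the (s x)"
| "val A s (Fn f ts) = fn A f (map (val A s) ts)"

primrec fv_tm :: "'f tm \<Rightarrow> nat set" where
  "fv_tm (Var x) = {x}"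
| "fv_tm (Fn f ts) = \<Union> (set (map fv_tm ts))"

primrec wf_tm :: "('f, 'p) vocabulary \<Rightarrow> 'f tm \<Rightarrow> bool" where
  "wf_tm \<tau> (Var x) \<longleftrightarrow> True"
| "wf_tm \<tau> (Fn f ts) \<longleftrightarrow> f \<in> fsyms \<tau> \<and> length ts = fun_arity \<tau> f \<and> list_all (wf_tm \<tau>) ts"

datatype ('f, 'p) fo =
    Eq "'f tm" "'f tm"
  | Rel 'p "'f tm list"
  | Neg "('f, 'p) fo"
  | And "('f, 'p) fo" "('f, 'p) fo"
  | Or "('f, 'p) fo" "('f, 'p) fo"
  | Ex nat "('f, 'p) fo"
  | All nat "('f, 'p) fo"

primrec fv_fo :: "('f, 'p) fo \<Rightarrow> nat set" where
  "fv_fo (Eq t u) = fv_tm t \<union> fv_tm u"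
| "fv_fo (Rel p ts) = \<Union> (set (map fv_tm ts))"
| "fv_fo (Neg \<alpha>) = fv_fo \<alpha>"
| "fv_fo (And \<alpha> \<beta>) = fv_fo \<alpha> \<union> fv_fo \<beta>"
| "fv_fo (Or \<alpha> \<beta>) = fv_fo \<alpha> \<union> fv_fo \<beta>"
| "fv_fo (Ex x \<alpha>) = fv_fo \<alpha> - {x}"
| "fv_fo (All x \<alpha>) = fv_fo \<alpha> - {x}"

primrec wf_fo :: "('f, 'p) vocabulary \<Rightarrow> ('f, 'p) fo \<Rightarrow> bool" where
  "wf_fo \<tau> (Eq t u) \<longleftrightarrow> wf_tm \<tau> t \<and> wf_tm \<tau> u"
| "wf_fo \<tau> (Rel p ts) \<longleftrightarrow> p \<in> psyms \<tau> \<and> length ts = pred_arity \<tau> p \<and> list_all (wf_tm \<tau>) ts"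
| "wf_fo \<tau> (Neg \<alpha>) \<longleftrightarrow> wf_fo \<tau> \<alpha>"
| "wf_fo \<tau> (And \<alpha> \<beta>) \<longleftrightarrow> wf_fo \<tau> \<alpha> \<and> wf_fo \<tau> \<beta>"
| "wf_fo \<tau> (Or \<alpha> \<beta>) \<longleftrightarrow> wf_fo \<tau> \<alpha> \<and> wf_fo \<tau> \<beta>"
| "wf_fo \<tau> (Ex x \<alpha>) \<longleftrightarrow> wf_fo \<tau> \<alpha>"
| "wf_fo \<tau> (All x \<alpha>) \<longleftrightarrow> wf_fo \<tau> \<alpha>"

primrec sat :: "('a, 'f, 'p) struct \<Rightarrow> 'a assignment \<Rightarrow> ('f, 'p) fo \<Rightarrow> bool" where
  "sat A s (Eq t u) \<longleftrightarrow> val A s t = val A s u"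
| "sat A s (Rel p ts) \<longleftrightarrow> map (val A s) ts \<in> rel A p"
| "sat A s (Neg \<alpha>) \<longleftrightarrow> \<not> sat A s \<alpha>"
| "sat A s (And \<alpha> \<beta>) \<longleftrightarrow> sat A s \<alpha> \<and> sat A s \<beta>"
| "sat A s (Or \<alpha> \<beta>) \<longleftrightarrow> sat A s \<alpha> \<or> sat A s \<beta>"
| "sat A s (Ex x \<alpha>) \<longleftrightarrow> (\<exists>a\<in>univ A. sat A (s(x \<mapsto> a)) \<alpha>)"
| "sat A s (All x \<alpha>) \<longleftrightarrow> (\<forall>a\<in>univ A. sat A (s(x \<mapsto> a)) \<alpha>)"

text \<open>A dependency \<open>(k, \<delta>)\<close> consists of a sentence \<open>\<delta>\<close> over a vocabulary with a single \<open>k\<close>-ary predicate,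
  written \<open>()\<close>, and no function symbols. The type of function symbols is kept as a parameter only
  so that \<open>\<delta>\<close> can be placed inside formulas over \<open>\<tau>\<close> without renaming its terms.\<close>

type_synonym 'f dependency = "nat \<times> ('f, unit) fo"

definition dep_vocabulary :: "nat \<Rightarrow> ('f, unit) vocabulary" where
  "dep_vocabulary k = \<lparr>fsyms = {}, fun_arity = (\<lambda>_. 0), psyms = {()}, pred_arity = (\<lambda>_. k)\<rparr>"

definition is_dependency :: "'f dependency \<Rightarrow> bool" where
  "is_dependency d \<longleftrightarrow> wf_fo (dep_vocabulary (fst d)) (snd d) \<and> fv_fo (snd d) = {}"

text \<open>The interpretation of function symbols below is irrelevant, as \<open>\<delta>\<close> contains none.\<close>

definition dep_holds :: "'a set \<Rightarrow> 'a list set \<Rightarrow> 'f dependency \<Rightarrow> bool" where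
  "dep_holds B Q d \<longleftrightarrow>
     sat \<lparr>univ = B, fn = (\<lambda>_ _. undefined), rel = (\<lambda>_. Q)\<rparr> Map.empty (snd d)"

type_synonym 'a team = "'a assignment set"

definition is_team :: "('a, 'f, 'p) struct \<Rightarrow> nat set \<Rightarrow> 'a team \<Rightarrow> bool" where
  "is_team A X T \<longleftrightarrow> (\<forall>s\<in>T. dom s = X \<and> ran s \<subseteq> univ A)"

definition team_val :: "('a, 'f, 'p) struct \<Rightarrow> 'f tm list \<Rightarrow> 'a team \<Rightarrow> 'a list set" where
  "team_val A ts T = {map (val A s) ts | s. s \<in> T}"

definition supplement :: "'a team \<Rightarrow> nat \<Rightarrow> ('a assignment \<Rightarrow> 'a set) \<Rightarrow> 'a team" where
  "supplement T x f = {s(x \<mapsto> a) | s a. s \<in> T \<and> a \<in> f s}"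

text \<open>An atom \<open>Dep d ts\<close> is labelled by the dependency \<open>d\<close> itself
  rather than by an index.\<close>

datatype ('f, 'p) tf =
    FO "('f, 'p) fo"
  | Dep "'f dependency" "'f tm list"
  | TNeg "('f, 'p) tf"
  | TAnd "('f, 'p) tf" "('f, 'p) tf"
  | TOr "('f, 'p) tf" "('f, 'p) tf"
  | TEx nat "('f, 'p) tf"
  | TAll nat "('f, 'p) tf"

primrec fv_tf :: "('f, 'p) tf \<Rightarrow> nat set" where
  "fv_tf (FO \<alpha>) = fv_fo \<alpha>"
| "fv_tf (Dep d ts) = \<Union> (set (map fv_tm ts))"
| "fv_tf (TNeg \<phi>) = fv_tf \<phi>"
| "fv_tf (TAnd \<phi> \<psi>) = fv_tf \<phi> \<union> fv_tf \<psi>"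
| "fv_tf (TOr \<phi> \<psi>) = fv_tf \<phi> \<union> fv_tf \<psi>"
| "fv_tf (TEx x \<phi>) = fv_tf \<phi> - {x}"
| "fv_tf (TAll x \<phi>) = fv_tf \<phi> - {x}"

primrec wf_tf :: "('f, 'p) vocabulary \<Rightarrow> 'f dependency set \<Rightarrow> ('f, 'p) tf \<Rightarrow> bool" where
  "wf_tf \<tau> D (FO \<alpha>) \<longleftrightarrow> wf_fo \<tau> \<alpha>"
| "wf_tf \<tau> D (Dep d ts) \<longleftrightarrow> d \<in> D \<and> length ts = fst d \<and> list_all (wf_tm \<tau>) ts"
| "wf_tf \<tau> D (TNeg \<phi>) \<longleftrightarrow> wf_tf \<tau> D \<phi>"
| "wf_tf \<tau> D (TAnd \<phi> \<psi>) \<longleftrightarrow> wf_tf \<tau> D \<phi> \<and> wf_tf \<tau> D \<psi>"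
| "wf_tf \<tau> D (TOr \<phi> \<psi>) \<longleftrightarrow> wf_tf \<tau> D \<phi> \<and> wf_tf \<tau> D \<psi>"
| "wf_tf \<tau> D (TEx x \<phi>) \<longleftrightarrow> wf_tf \<tau> D \<phi>"
| "wf_tf \<tau> D (TAll x \<phi>) \<longleftrightarrow> wf_tf \<tau> D \<phi>"

text \<open>The connectives and quantifiers of \<open>FO(\<sim>, D)\<close> and of first-order logic are the same symbols,
  so e.g. \<open>TAnd (FO \<alpha>) (FO \<beta>)\<close> is the first-order formula \<open>And \<alpha> \<beta>\<close>. The function \<open>as_fo\<close>
  recognises the first-order formulas; they are treated first in the semantics and the
  translation.\<close>

primrec as_fo :: "('f, 'p) tf \<Rightarrow> ('f, 'p) fo option" where
  "as_fo (FO \<alpha>) = Some \<alpha>"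
| "as_fo (Dep d ts) = None"
| "as_fo (TNeg \<phi>) = None"
| "as_fo (TAnd \<phi> \<psi>) =
     (case (as_fo \<phi>, as_fo \<psi>) of (Some \<alpha>, Some \<beta>) \<Rightarrow> Some (And \<alpha> \<beta>) | _ \<Rightarrow> None)"
| "as_fo (TOr \<phi> \<psi>) =
     (case (as_fo \<phi>, as_fo \<psi>) of (Some \<alpha>, Some \<beta>) \<Rightarrow> Some (Or \<alpha> \<beta>) | _ \<Rightarrow> None)"
| "as_fo (TEx x \<phi>) = map_option (Ex x) (as_fo \<phi>)"
| "as_fo (TAll x \<phi>) = map_option (All x) (as_fo \<phi>)"

definition flat_sat :: "('a, 'f, 'p) struct \<Rightarrow> 'a team \<Rightarrow> ('f, 'p) fo \<Rightarrow> bool" where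
  "flat_sat A T \<alpha> \<longleftrightarrow> (\<forall>s\<in>T. sat A s \<alpha>)"

primrec team_sat :: "('a, 'f, 'p) struct \<Rightarrow> 'a team \<Rightarrow> ('f, 'p) tf \<Rightarrow> bool" where
  "team_sat A T (FO \<alpha>) \<longleftrightarrow> flat_sat A T \<alpha>"
| "team_sat A T (Dep d ts) \<longleftrightarrow> dep_holds (univ A) (team_val A ts T) d"
| "team_sat A T (TNeg \<psi>) \<longleftrightarrow> \<not> team_sat A T \<psi>"
| "team_sat A T (TAnd \<psi> \<theta>) \<longleftrightarrow> (case as_fo (TAnd \<psi> \<theta>) of
      Some \<alpha> \<Rightarrow> flat_sat A T \<alpha>
    | None \<Rightarrow> team_sat A T \<psi> \<and> team_sat A T \<theta>)"
| "team_sat A T (TOr \<psi> \<theta>) \<longleftrightarrow> (case as_fo (TOr \<psi> \<theta>) of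
      Some \<alpha> \<Rightarrow> flat_sat A T \<alpha>
    | None \<Rightarrow> (\<exists>S U. S \<subseteq> T \<and> U \<subseteq> T \<and> T = S \<union> U \<and> team_sat A S \<psi> \<and> team_sat A U \<theta>))"
| "team_sat A T (TEx x \<psi>) \<longleftrightarrow> (case as_fo (TEx x \<psi>) of
      Some \<alpha> \<Rightarrow> flat_sat A T \<alpha>
    | None \<Rightarrow> (\<exists>f. (\<forall>s\<in>T. f s \<in> Pow (univ A) - {{}}) \<and> team_sat A (supplement T x f) \<psi>))"
| "team_sat A T (TAll x \<psi>) \<longleftrightarrow> (case as_fo (TAll x \<psi>) of
      Some \<alpha> \<Rightarrow> flat_sat A T \<alpha>
    | None \<Rightarrow> team_sat A (supplement T x (\<lambda>_. univ A)) \<psi>)"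

text \<open>A predicate variable \<open>PV i n\<close> has name \<open>i\<close> and arity \<open>n\<close>.\<close>

datatype pvar = PV (pname: nat) (pvar_arity: nat)

datatype 'p psym = Sym 'p | PVar pvar

datatype ('f, 'p) so =
    SEq "'f tm" "'f tm"
  | SRel "'p psym" "'f tm list"
  | SNeg "('f, 'p) so"
  | SAnd "('f, 'p) so" "('f, 'p) so"
  | SOr "('f, 'p) so" "('f, 'p) so"
  | SEx nat "('f, 'p) so"
  | SAll nat "('f, 'p) so"
  | SEx2 pvar "('f, 'p) so"
  | SAll2 pvar "('f, 'p) so"

definition SImp :: "('f, 'p) so \<Rightarrow> ('f, 'p) so \<Rightarrow> ('f, 'p) so" where
  "SImp \<Phi> \<Psi> = SOr (SNeg \<Phi>) \<Psi>"

definition SIff :: "('f, 'p) so \<Rightarrow> ('f, 'p) so \<Rightarrow> ('f, 'p) so" where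
  "SIff \<Phi> \<Psi> = SAnd (SImp \<Phi> \<Psi>) (SImp \<Psi> \<Phi>)"

definition SExs :: "nat list \<Rightarrow> ('f, 'p) so \<Rightarrow> ('f, 'p) so" where
  "SExs xs \<Phi> = foldr SEx xs \<Phi>"

definition SAlls :: "nat list \<Rightarrow> ('f, 'p) so \<Rightarrow> ('f, 'p) so" where
  "SAlls xs \<Phi> = foldr SAll xs \<Phi>"

definition papp :: "pvar \<Rightarrow> nat list \<Rightarrow> ('f, 'p) so" where
  "papp R xs = SRel (PVar R) (map Var xs)"

primrec so_sat :: "('a, 'f, 'p) struct \<Rightarrow> 'a assignment \<Rightarrow> (pvar \<Rightarrow> 'a list set) \<Rightarrow>
    ('f, 'p) so \<Rightarrow> bool" where
  "so_sat A s \<sigma> (SEq t u) \<longleftrightarrow> val A s t = val A s u"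
| "so_sat A s \<sigma> (SRel P ts) \<longleftrightarrow>
     map (val A s) ts \<in> (case P of Sym p \<Rightarrow> rel A p | PVar R \<Rightarrow> \<sigma> R)"
| "so_sat A s \<sigma> (SNeg \<Phi>) \<longleftrightarrow> \<not> so_sat A s \<sigma> \<Phi>"
| "so_sat A s \<sigma> (SAnd \<Phi> \<Psi>) \<longleftrightarrow> so_sat A s \<sigma> \<Phi> \<and> so_sat A s \<sigma> \<Psi>"
| "so_sat A s \<sigma> (SOr \<Phi> \<Psi>) \<longleftrightarrow> so_sat A s \<sigma> \<Phi> \<or> so_sat A s \<sigma> \<Psi>"
| "so_sat A s \<sigma> (SEx x \<Phi>) \<longleftrightarrow> (\<exists>a\<in>univ A. so_sat A (s(x \<mapsto> a)) \<sigma> \<Phi>)"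
| "so_sat A s \<sigma> (SAll x \<Phi>) \<longleftrightarrow> (\<forall>a\<in>univ A. so_sat A (s(x \<mapsto> a)) \<sigma> \<Phi>)"
| "so_sat A s \<sigma> (SEx2 S \<Phi>) \<longleftrightarrow> (\<exists>Q\<subseteq>tuples (pvar_arity S) (univ A). so_sat A s (\<sigma>(S := Q)) \<Phi>)"
| "so_sat A s \<sigma> (SAll2 S \<Phi>) \<longleftrightarrow> (\<forall>Q\<subseteq>tuples (pvar_arity S) (univ A). so_sat A s (\<sigma>(S := Q)) \<Phi>)"

text \<open>\<open>A \<Turnstile> \<Phi>(Q)\<close> for a formula \<open>\<Phi>(R)\<close> whose only free variable is the predicate variable
  \<open>R\<close>; the values of all other variables are irrelevant.\<close>

definition so_models :: "('a, 'f, 'p) struct \<Rightarrow> ('f, 'p) so \<Rightarrow> pvar \<Rightarrow> 'a list set \<Rightarrow> bool" where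
  "so_models A \<Phi> R Q \<longleftrightarrow> so_sat A Map.empty ((\<lambda>_. {})(R := Q)) \<Phi>"

text \<open>First-order formulas as second-order formulas, with each relation symbol \<open>p\<close> replaced by
  \<open>h p\<close>. With \<open>h = Sym\<close> this is the inclusion; with \<open>h = (\<lambda>_. PVar S)\<close> it maps a
  dependency \<open>\<delta>\<close> to \<open>\<delta>(S)\<close>.\<close>

primrec so_of_fo :: "('p \<Rightarrow> 'q psym) \<Rightarrow> ('f, 'p) fo \<Rightarrow> ('f, 'q) so" where
  "so_of_fo h (Eq t u) = SEq t u"
| "so_of_fo h (Rel p ts) = SRel (h p) ts"
| "so_of_fo h (Neg \<alpha>) = SNeg (so_of_fo h \<alpha>)"
| "so_of_fo h (And \<alpha> \<beta>) = SAnd (so_of_fo h \<alpha>) (so_of_fo h \<beta>)"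
| "so_of_fo h (Or \<alpha> \<beta>) = SOr (so_of_fo h \<alpha>) (so_of_fo h \<beta>)"
| "so_of_fo h (Ex x \<alpha>) = SEx x (so_of_fo h \<alpha>)"
| "so_of_fo h (All x \<alpha>) = SAll x (so_of_fo h \<alpha>)"

text \<open>In \<open>eta \<phi> xs R\<close> the arity of \<open>R\<close> is meant to be \<open>length xs\<close>.
  The only free variable of \<open>eta \<phi> xs R\<close> is \<open>R\<close>, so predicate variables with a larger
  name than \<open>R\<close> are fresh.\<close>

definition adjoin :: "nat list \<Rightarrow> nat \<Rightarrow> nat list" where
  "adjoin xs y = (if y \<in> set xs then xs else xs @ [y])"

definition fresh_vars :: "nat \<Rightarrow> nat list \<Rightarrow> nat list" where
  "fresh_vars k xs = (let m = Suc (Max (insert 0 (set xs))) in [m..<m + k])"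

definition fresh1 :: "pvar \<Rightarrow> nat \<Rightarrow> pvar" where
  "fresh1 R n = PV (pname R + 1) n"

definition fresh2 :: "pvar \<Rightarrow> nat \<Rightarrow> pvar" where
  "fresh2 R n = PV (pname R + 2) n"

definition eta_fo :: "nat list \<Rightarrow> pvar \<Rightarrow> ('f, 'p) fo \<Rightarrow> ('f, 'p) so" where
  "eta_fo xs R \<alpha> = SAlls xs (SImp (papp R xs) (so_of_fo Sym \<alpha>))"

primrec eta :: "('f, 'p) tf \<Rightarrow> nat list \<Rightarrow> pvar \<Rightarrow> ('f, 'p) so" where
  "eta (FO \<alpha>) xs R = eta_fo xs R \<alpha>"
| "eta (Dep d ts) xs R =
     (let S = fresh1 R (fst d); zs = fresh_vars (fst d) xs in
      SEx2 S (SAnd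
        (SAlls zs (SIff (papp S zs)
           (SExs xs (foldl SAnd (papp R xs) (map2 (\<lambda>t z. SEq t (Var z)) ts zs)))))
        (so_of_fo (\<lambda>_. PVar S) (snd d))))"
| "eta (TNeg \<psi>) xs R = SNeg (eta \<psi> xs R)"
| "eta (TAnd \<psi> \<theta>) xs R = (case as_fo (TAnd \<psi> \<theta>) of
      Some \<alpha> \<Rightarrow> eta_fo xs R \<alpha>
    | None \<Rightarrow> SAnd (eta \<psi> xs R) (eta \<theta> xs R))"
| "eta (TOr \<psi> \<theta>) xs R = (case as_fo (TOr \<psi> \<theta>) of
      Some \<alpha> \<Rightarrow> eta_fo xs R \<alpha>
    | None \<Rightarrow>
       (let S = fresh1 R (length xs); U = fresh2 R (length xs) in
        SEx2 S (SEx2 U (SAnd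
          (SAlls xs (SIff (papp R xs) (SOr (papp S xs) (papp U xs))))
          (SAnd (eta \<psi> xs S) (eta \<theta> xs U))))))"
| "eta (TEx y \<psi>) xs R = (case as_fo (TEx y \<psi>) of
      Some \<alpha> \<Rightarrow> eta_fo xs R \<alpha>
    | None \<Rightarrow>
       (let xy = adjoin xs y; S = fresh1 R (length xy) in
        SEx2 S (SAnd
          (SAlls xs (SIff (SEx y (papp R xs)) (SEx y (papp S xy))))
          (eta \<psi> xy S))))"
| "eta (TAll y \<psi>) xs R = (case as_fo (TAll y \<psi>) of
      Some \<alpha> \<Rightarrow> eta_fo xs R \<alpha>
    | None \<Rightarrow>
       (let xy = adjoin xs y; S = fresh1 R (length xy) in
        SEx2 S (SAnd
          (SAlls xs (SIff (SEx y (papp R xs)) (SEx y (papp S xy))))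
          (SAnd (eta \<psi> xy S)
            (SAlls xs (SImp (papp R xs) (SAll y (papp S xy))))))))"

end

theory Submission
  imports Defs
begin

text \<open>Induction on \<open>\<phi>\<close>, with the claim generalised from the relation \<open>xs\<langle>T\<rangle>\<close> to all relations that
  agree with it on the tuples of the form \<open>map v xs\<close>. This is needed since \<open>xs\<close> may
  contain repetitions: the formulas \<open>eta\<close> constrain their quantified predicates only on such tuples.
  The team may have a larger domain than \<open>xs\<close>, so a witness on the second-order side is pulled
  back along the projection to \<open>xs\<close>: a cover of the relation splits the team, and a relation \<open>Q\<close>
  witnessing \<open>\<exists>y\<close> yields the supplementing function that maps \<open>t\<close> to all \<open>a\<close> for which the
  projection of \<open>t(y \<mapsto> a)\<close> is in \<open>Q\<close>.\<close>

section \<open>Coincidence\<close>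

text \<open>Agreement is stated through \<open>the\<close>, which is how \<open>val\<close> reads an
  assignment. Team members and valuations can then be compared without reference to their
  domains.\<close>

lemma val_cong:
  assumes "\<And>x. x \<in> fv_tm t \<Longrightarrow> the (s x) = the (s' x)"
  shows "val A s t = val A s' t"
  using assms
proof (induction t)
  case (Fn f ts)
  then have "map (val A s) ts = map (val A s') ts"
    by auto
  then show ?case
    by (simp cong: map_cong)
qed simp

lemma val_in_univ:
  assumes "is_structure \<tau> A" "wf_tm \<tau> t" "\<And>x. x \<in> fv_tm t \<Longrightarrow> the (s x) \<in> univ A"
  shows "val A s t \<in> univ A"
  using assms(2,3)
proof (induction t)
  case (Fn f ts)
  then have "map (val A s) ts \<in> tuples (fun_arity \<tau> f) (univ A)"
    by (auto simp: tuples_def list_all_iff)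
  then show ?case
    using assms(1) Fn.prems(1) by (auto simp: is_structure_def)
qed simp

lemma sat_cong:
  assumes "\<And>x. x \<in> fv_fo \<alpha> \<Longrightarrow> the (s x) = the (s' x)"
  shows "sat A s \<alpha> \<longleftrightarrow> sat A s' \<alpha>"
  using assms
proof (induction \<alpha> arbitrary: s s')
  case (Eq t u)
  have "val A s t = val A s' t" "val A s u = val A s' u"
    using Eq by (auto intro!: val_cong)
  then show ?case by simp
next
  case (Rel p ts)
  have "map (val A s) ts = map (val A s') ts"
    using Rel by (auto intro!: val_cong)
  then show ?case by (simp cong: map_cong)
next
  case (Neg \<alpha>)
  have "sat A s \<alpha> \<longleftrightarrow> sat A s' \<alpha>"
    by (rule Neg.IH) (use Neg.prems in auto)
  then show ?case by simp
next
  case (And \<alpha> \<beta>)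
  have "sat A s \<alpha> \<longleftrightarrow> sat A s' \<alpha>" "sat A s \<beta> \<longleftrightarrow> sat A s' \<beta>"
    by (rule And.IH; use And.prems in simp)+
  then show ?case by simp
next
  case (Or \<alpha> \<beta>)
  have "sat A s \<alpha> \<longleftrightarrow> sat A s' \<alpha>" "sat A s \<beta> \<longleftrightarrow> sat A s' \<beta>"
    by (rule Or.IH; use Or.prems in simp)+
  then show ?case by simp
next
  case (Ex x \<alpha>)
  have "sat A (s(x \<mapsto> a)) \<alpha> \<longleftrightarrow> sat A (s'(x \<mapsto> a)) \<alpha>" for a
    by (rule Ex.IH) (use Ex.prems in auto)
  then show ?case by simp
next
  case (All x \<alpha>)
  have "sat A (s(x \<mapsto> a)) \<alpha> \<longleftrightarrow> sat A (s'(x \<mapsto> a)) \<alpha>" for a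
    by (rule All.IH) (use All.prems in auto)
  then show ?case by simp
qed

lemma so_sat_so_of_fo_Sym: "so_sat A s \<sigma> (so_of_fo Sym \<alpha>) \<longleftrightarrow> sat A s \<alpha>"
  by (induction \<alpha> arbitrary: s) auto

lemma wf_tm_dep_vocabulary: "wf_tm (dep_vocabulary k) t \<Longrightarrow> \<exists>x. t = Var x"
  by (cases t) (auto simp: dep_vocabulary_def)

text \<open>A dependency contains no function symbols, so its terms are variables and
  \<open>g\<close> may be arbitrary. This bridges the functions of \<open>A\<close> and the dummy
  ones in \<open>dep_holds\<close>. Two assignments are carried along because quantifiers update
  both; for a sentence the premise on them is vacuous.\<close>

lemma so_sat_so_of_fo_PVar:
  assumes "wf_fo (dep_vocabulary k) \<delta>"
    and "\<And>x. x \<in> fv_fo \<delta> \<Longrightarrow> the (s x) = the (s' x)"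
  shows "so_sat A s \<sigma> (so_of_fo (\<lambda>_. PVar S) \<delta>) \<longleftrightarrow>
    sat \<lparr>univ = univ A, fn = g, rel = (\<lambda>_. \<sigma> S)\<rparr> s' \<delta>"
  using assms
proof (induction \<delta> arbitrary: s s')
  case (Eq t u)
  then show ?case
    by (auto dest!: wf_tm_dep_vocabulary)
next
  case (Rel p ts)
  have val: "val A s t = val \<lparr>univ = univ A, fn = g, rel = (\<lambda>_::unit. \<sigma> S)\<rparr> s' t" if "t \<in> set ts" for t
  proof -
    have "wf_tm (dep_vocabulary k) t"
      using Rel.prems(1) that by (auto simp: list_all_iff)
    then obtain x where "t = Var x"
      using wf_tm_dep_vocabulary by blast
    then show ?thesis
      using Rel.prems(2) that by force
  qed
  have "map (val A s) ts = map (val \<lparr>univ = univ A, fn = g, rel = (\<lambda>_::unit. \<sigma> S)\<rparr> s') ts"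
    by (rule map_cong[OF refl val])
  then show ?case
    by (simp only: so_of_fo.simps so_sat.simps sat.simps psym.case struct.select_convs)
next
  case (Neg \<delta>)
  have "so_sat A s \<sigma> (so_of_fo (\<lambda>_. PVar S) \<delta>) \<longleftrightarrow>
    sat \<lparr>univ = univ A, fn = g, rel = (\<lambda>_. \<sigma> S)\<rparr> s' \<delta>"
    by (rule Neg.IH) (use Neg.prems in auto)
  then show ?case by simp
next
  case (And \<delta> \<epsilon>)
  have "so_sat A s \<sigma> (so_of_fo (\<lambda>_. PVar S) \<delta>) \<longleftrightarrow>
    sat \<lparr>univ = univ A, fn = g, rel = (\<lambda>_. \<sigma> S)\<rparr> s' \<delta>"
    by (rule And.IH) (use And.prems in auto)
  moreover have "so_sat A s \<sigma> (so_of_fo (\<lambda>_. PVar S) \<epsilon>) \<longleftrightarrow>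
    sat \<lparr>univ = univ A, fn = g, rel = (\<lambda>_. \<sigma> S)\<rparr> s' \<epsilon>"
    by (rule And.IH) (use And.prems in auto)
  ultimately show ?case by simp
next
  case (Or \<delta> \<epsilon>)
  have "so_sat A s \<sigma> (so_of_fo (\<lambda>_. PVar S) \<delta>) \<longleftrightarrow>
    sat \<lparr>univ = univ A, fn = g, rel = (\<lambda>_. \<sigma> S)\<rparr> s' \<delta>"
    by (rule Or.IH) (use Or.prems in auto)
  moreover have "so_sat A s \<sigma> (so_of_fo (\<lambda>_. PVar S) \<epsilon>) \<longleftrightarrow>
    sat \<lparr>univ = univ A, fn = g, rel = (\<lambda>_. \<sigma> S)\<rparr> s' \<epsilon>"
    by (rule Or.IH) (use Or.prems in auto)
  ultimately show ?case by simp
next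
  case (Ex x \<delta>)
  have "so_sat A (s(x \<mapsto> a)) \<sigma> (so_of_fo (\<lambda>_. PVar S) \<delta>) \<longleftrightarrow>
    sat \<lparr>univ = univ A, fn = g, rel = (\<lambda>_. \<sigma> S)\<rparr> (s'(x \<mapsto> a)) \<delta>" for a
    by (rule Ex.IH) (use Ex.prems in auto)
  then show ?case by simp
next
  case (All x \<delta>)
  have "so_sat A (s(x \<mapsto> a)) \<sigma> (so_of_fo (\<lambda>_. PVar S) \<delta>) \<longleftrightarrow>
    sat \<lparr>univ = univ A, fn = g, rel = (\<lambda>_. \<sigma> S)\<rparr> (s'(x \<mapsto> a)) \<delta>" for a
    by (rule All.IH) (use All.prems in auto)
  then show ?case by simp
qed

section \<open>Formulas over total valuations\<close>

abbreviation updv :: "'a assignment \<Rightarrow> nat list \<Rightarrow> (nat \<Rightarrow> 'a) \<Rightarrow> 'a assignment" where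
  "updv s xs v \<equiv> override_on s (\<lambda>x. Some (v x)) (set xs)"

lemma updv_Cons: "updv s (x # xs) v = updv (s(x \<mapsto> v x)) xs v"
  by (auto simp: override_on_def fun_eq_iff)

text \<open>If \<open>x\<close> occurs again in \<open>xs\<close>, the value \<open>a\<close> chosen
  first is overwritten, so \<open>v\<close> must stay as it is.\<close>

lemma updv_Cons_upd: "updv s (x # xs) (if x \<in> set xs then v else v(x := a)) = updv (s(x \<mapsto> a)) xs v"
  by (auto simp: override_on_def fun_eq_iff)

text \<open>A block of quantifiers becomes a single quantifier over total valuations. This is exact
  even when \<open>xs\<close> repeats variables: the innermost binding wins, and a valuation records
  just the surviving value.\<close>

lemma so_sat_SAlls:
  assumes "univ A \<noteq> {}"
  shows "so_sat A s \<sigma> (SAlls xs \<Phi>) \<longleftrightarrow> (\<forall>v. range v \<subseteq> univ A \<longrightarrow> so_sat A (updv s xs v) \<sigma> \<Phi>)"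
proof (induction xs arbitrary: s)
  case Nil
  \<comment> \<open>Even the empty block is read as a quantifier over valuations, so at least one
    must exist.\<close>
  obtain a where "a \<in> univ A"
    using assms by blast
  then have "\<exists>v :: nat \<Rightarrow> 'a. range v \<subseteq> univ A"
    by (intro exI[of _ "\<lambda>_. a"]) auto
  then show ?case
    by (auto simp: SAlls_def)
next
  case (Cons x xs)
  have "so_sat A s \<sigma> (SAlls (x # xs) \<Phi>) \<longleftrightarrow>
      (\<forall>a\<in>univ A. \<forall>v. range v \<subseteq> univ A \<longrightarrow> so_sat A (updv (s(x \<mapsto> a)) xs v) \<sigma> \<Phi>)"
  proof -
    have "SAlls (x # xs) \<Phi> = SAll x (SAlls xs \<Phi>)"
      by (simp add: SAlls_def)
    then show ?thesis
      by (simp only: so_sat.simps Cons.IH)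
  qed
  also have "\<dots> \<longleftrightarrow> (\<forall>v. range v \<subseteq> univ A \<longrightarrow> so_sat A (updv s (x # xs) v) \<sigma> \<Phi>)"
  proof (intro iffI allI impI ballI)
    fix v :: "nat \<Rightarrow> 'a" assume "range v \<subseteq> univ A"
      and "\<forall>a\<in>univ A. \<forall>v. range v \<subseteq> univ A \<longrightarrow> so_sat A (updv (s(x \<mapsto> a)) xs v) \<sigma> \<Phi>"
    then show "so_sat A (updv s (x # xs) v) \<sigma> \<Phi>"
      unfolding updv_Cons by blast
  next
    fix a and v :: "nat \<Rightarrow> 'a"
    assume *: "\<forall>v. range v \<subseteq> univ A \<longrightarrow> so_sat A (updv s (x # xs) v) \<sigma> \<Phi>"
      and "a \<in> univ A" "range v \<subseteq> univ A"
    then have "range (if x \<in> set xs then v else v(x := a)) \<subseteq> univ A"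
      by auto
    then show "so_sat A (updv (s(x \<mapsto> a)) xs v) \<sigma> \<Phi>"
      using * updv_Cons_upd[of s x xs v a] by metis
  qed
  finally show ?case .
qed

lemma so_sat_SExs:
  assumes "univ A \<noteq> {}"
  shows "so_sat A s \<sigma> (SExs xs \<Phi>) \<longleftrightarrow> (\<exists>v. range v \<subseteq> univ A \<and> so_sat A (updv s xs v) \<sigma> \<Phi>)"
proof -
  have "so_sat A s \<sigma> (SExs xs \<Phi>) \<longleftrightarrow> \<not> so_sat A s \<sigma> (SAlls xs (SNeg \<Phi>))"
    by (induction xs arbitrary: s) (auto simp: SAlls_def SExs_def)
  then show ?thesis
    using so_sat_SAlls[OF assms] by auto
qed

lemma so_sat_papp: "so_sat A s \<sigma> (papp R xs) \<longleftrightarrow> map (\<lambda>x. the (s x)) xs \<in> \<sigma> R"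
  by (simp add: papp_def comp_def)

lemma so_sat_SImp: "so_sat A s \<sigma> (SImp \<Phi> \<Psi>) \<longleftrightarrow> (so_sat A s \<sigma> \<Phi> \<longrightarrow> so_sat A s \<sigma> \<Psi>)"
  by (auto simp: SImp_def)

lemma so_sat_SIff: "so_sat A s \<sigma> (SIff \<Phi> \<Psi>) \<longleftrightarrow> (so_sat A s \<sigma> \<Phi> \<longleftrightarrow> so_sat A s \<sigma> \<Psi>)"
  by (auto simp: SIff_def so_sat_SImp)

lemma so_sat_foldl_SAnd:
  "so_sat A s \<sigma> (foldl SAnd \<Phi> \<Psi>s) \<longleftrightarrow> so_sat A s \<sigma> \<Phi> \<and> (\<forall>\<Psi>\<in>set \<Psi>s. so_sat A s \<sigma> \<Psi>)"
  by (induction \<Psi>s arbitrary: \<Phi>) auto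

lemma so_sat_papp_updv:
  "set ys \<subseteq> set xs \<Longrightarrow> so_sat A (updv s xs v) \<sigma> (papp R ys) \<longleftrightarrow> map v ys \<in> \<sigma> R"
proof -
  assume "set ys \<subseteq> set xs"
  then have "map (\<lambda>x. the (updv s xs v x)) ys = map v ys"
    by (auto simp: override_on_def)
  then show ?thesis
    by (simp only: so_sat_papp)
qed

lemma so_sat_papp_updv_upd:
  "set ys \<subseteq> insert y (set xs) \<Longrightarrow>
    so_sat A ((updv s xs v)(y \<mapsto> a)) \<sigma> (papp R ys) \<longleftrightarrow> map (v(y := a)) ys \<in> \<sigma> R"
proof -
  assume "set ys \<subseteq> insert y (set xs)"
  then have "map (\<lambda>x. the (((updv s xs v)(y \<mapsto> a)) x)) ys = map (v(y := a)) ys"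
    by (auto simp: override_on_def)
  then show ?thesis
    by (simp only: so_sat_papp)
qed

section \<open>Adjoined and fresh variables\<close>

lemma set_adjoin: "set (adjoin xs y) = insert y (set xs)"
  by (auto simp: adjoin_def)

lemma fresh_vars:
  "length (fresh_vars k xs) = k" "distinct (fresh_vars k xs)" "set (fresh_vars k xs) \<inter> set xs = {}"
proof -
  have "x \<le> Max (insert 0 (set xs))" if "x \<in> set xs" for x
    using that by simp
  then show "set (fresh_vars k xs) \<inter> set xs = {}"
    by (fastforce simp: fresh_vars_def Let_def)
qed (simp_all add: fresh_vars_def Let_def)

text \<open>The names alone separate these predicate variables, whatever their arities.\<close>

lemma fresh_simps [simp]: "fresh1 R n \<noteq> R" "R \<noteq> fresh1 R n" "fresh2 R n \<noteq> R" "R \<noteq> fresh2 R n"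
  "fresh1 R n \<noteq> fresh2 R m" "pvar_arity (fresh1 R n) = n" "pvar_arity (fresh2 R n) = n"
  by (cases R; simp add: fresh1_def fresh2_def)+

text \<open>Distinctness leaves the value at each position free. An equivalence quantified over such
  \<open>zs\<close> therefore determines a relation on all tuples.\<close>

lemma distinct_surj_map:
  assumes "distinct zs" "length zs = length as" "set as \<subseteq> U" "U \<noteq> {}"
  shows "\<exists>v. range v \<subseteq> U \<and> map v zs = as"
proof -
  obtain b where b: "b \<in> U"
    using assms(4) by blast
  \<comment> \<open>Off \<open>zs\<close> the value is the default \<open>b\<close>, which keeps the
    valuation within \<open>U\<close>.\<close>
  define v where "v z = (case map_of (zip zs as) z of Some a \<Rightarrow> a | None \<Rightarrow> b)" for z
  have "v z \<in> U" for z
  proof (cases "map_of (zip zs as) z")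
    case (Some a)
    then have "a \<in> set as"
      by (blast dest: map_of_SomeD set_zip_rightD)
    then show ?thesis
      using assms(3) Some by (auto simp: v_def)
  qed (simp add: v_def b)
  then have "range v \<subseteq> U" by auto
  moreover have "map v zs = as"
  proof (rule nth_equalityI)
    fix i assume "i < length (map v zs)"
    then have i: "i < length zs" by simp
    then have "map_of (zip zs as) (zs ! i) = Some (as ! i)"
      using assms(1,2) by (simp add: map_of_zip_nth)
    then show "map v zs ! i = as ! i"
      using i by (simp add: v_def)
  qed (simp add: assms(2))
  ultimately show ?thesis by blast
qed

section \<open>Relations representing a team\<close>

text \<open>Weaker than \<open>is_team\<close>: the domain of the assignments is left open, and only
  the values at variables in \<open>X\<close> are controlled. Supplementing preserves this whether
  or not the variable was already in the domain.\<close>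

definition team_in :: "'a set \<Rightarrow> nat set \<Rightarrow> 'a team \<Rightarrow> bool" where
  "team_in U X T \<longleftrightarrow> (\<forall>t\<in>T. \<forall>x\<in>X. the (t x) \<in> U)"

definition agree :: "nat set \<Rightarrow> (nat \<Rightarrow> 'a) \<Rightarrow> 'a assignment \<Rightarrow> bool" where
  "agree X v t \<longleftrightarrow> (\<forall>x\<in>X. v x = the (t x))"

definition represents :: "'a set \<Rightarrow> nat list \<Rightarrow> 'a team \<Rightarrow> 'a list set \<Rightarrow> bool" where
  "represents U xs T Q \<longleftrightarrow>
     (\<forall>v. range v \<subseteq> U \<longrightarrow> (map v xs \<in> Q \<longleftrightarrow> (\<exists>t\<in>T. agree (set xs) v t)))"

lemma team_val_Var: "team_val A (map Var xs) T = (\<lambda>t. map (\<lambda>x. the (t x)) xs) ` T"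
  by (auto simp: team_val_def comp_def)

lemma agree_map: "agree (set xs) v t \<longleftrightarrow> map v xs = map (\<lambda>x. the (t x)) xs"
  by (simp add: agree_def)

lemma represents_image: "represents U xs T ((\<lambda>t. map (\<lambda>x. the (t x)) xs) ` T)"
  by (auto simp: represents_def agree_map)

lemma image_tuples:
  "team_in U (set xs) T \<Longrightarrow> (\<lambda>t. map (\<lambda>x. the (t x)) xs) ` T \<subseteq> tuples (length xs) U"
  by (auto simp: team_in_def tuples_def)

text \<open>The bridge between the two kinds of quantification: quantifier blocks range over
  valuations, flatness and team values over team members.\<close>

lemma total_extension:
  assumes "team_in U (set xs) T" "U \<noteq> {}" "t \<in> T"
  obtains v where "range v \<subseteq> U" "agree (set xs) v t"
proof -
  obtain a where "a \<in> U"
    using assms(2) by blast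
  then show thesis
    using assms by (intro that[of "\<lambda>x. if x \<in> set xs then the (t x) else a"])
      (auto simp: team_in_def agree_def)
qed

text \<open>Quantifying out \<open>y\<close> forgets what \<open>v\<close> says at \<open>y\<close>,
  also when \<open>y\<close> does not occur in \<open>xs\<close>. This evaluates both sides of the
  equivalence in the quantifier clauses.\<close>

lemma represents_exI:
  assumes "team_in U (set xs) T" "U \<noteq> {}" "represents U xs T Q" "range v \<subseteq> U"
  shows "(\<exists>a\<in>U. map (v(y := a)) xs \<in> Q) \<longleftrightarrow> (\<exists>t\<in>T. agree (set xs - {y}) v t)"
proof -
  have "range (v(y := a)) \<subseteq> U" if "a \<in> U" for a
    using assms(4) that by auto
  then have "(\<exists>a\<in>U. map (v(y := a)) xs \<in> Q) \<longleftrightarrow> (\<exists>a\<in>U. \<exists>t\<in>T. agree (set xs) (v(y := a)) t)"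
    using assms(3) unfolding represents_def by blast
  also have "\<dots> \<longleftrightarrow> (\<exists>t\<in>T. agree (set xs - {y}) v t)"
  proof
    assume "\<exists>t\<in>T. agree (set xs - {y}) v t"
    then obtain t where t: "t \<in> T" "agree (set xs - {y}) v t" by blast
    then obtain w where "range w \<subseteq> U" "agree (set xs) w t"
      using total_extension assms(1,2) by metis
    \<comment> \<open>The witness \<open>w y\<close> is the value of \<open>t\<close> if
      \<open>y\<close> is in \<open>xs\<close>, and otherwise just some element of
      \<open>U\<close>.\<close>
    then have "w y \<in> U" "agree (set xs) (v(y := w y)) t"
      using t(2) by (auto simp: agree_def)
    then show "\<exists>a\<in>U. \<exists>t\<in>T. agree (set xs) (v(y := a)) t"
      using t(1) by blast
  next
    assume "\<exists>a\<in>U. \<exists>t\<in>T. agree (set xs) (v(y := a)) t"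
    then obtain a t where "t \<in> T" "agree (set xs) (v(y := a)) t" by blast
    then show "\<exists>t\<in>T. agree (set xs - {y}) v t"
      unfolding agree_def by (metis DiffE fun_upd_other singletonI)
  qed
  finally show ?thesis .
qed

lemma team_in_supplement:
  assumes "team_in U X T" "\<forall>t\<in>T. f t \<subseteq> U"
  shows "team_in U (insert y X) (supplement T y f)"
  using assms by (fastforce simp: team_in_def supplement_def)

text \<open>Supplementing changes assignments at \<open>y\<close> only, and nonempty choices leave
  every member at least one descendant.\<close>

lemma supplement_agree:
  assumes "\<forall>t\<in>T. f t \<noteq> {}"
  shows "(\<exists>t\<in>supplement T y f. agree (insert y X - {y}) v t) \<longleftrightarrow> (\<exists>t\<in>T. agree (X - {y}) v t)"
proof
  assume "\<exists>t\<in>T. agree (X - {y}) v t"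
  then obtain t a where "t \<in> T" "agree (X - {y}) v t" "a \<in> f t"
    using assms by blast
  then show "\<exists>t\<in>supplement T y f. agree (insert y X - {y}) v t"
    by (intro bexI[of _ "t(y \<mapsto> a)"]) (auto simp: agree_def supplement_def)
qed (fastforce simp: agree_def supplement_def)

text \<open>A supplemented assignment that matches \<open>v\<close> must have received the value
  \<open>v y\<close>.\<close>

lemma supplement_agree_insert:
  "(\<exists>t\<in>supplement T y f. agree (insert y X) v t) \<longleftrightarrow> (\<exists>t\<in>T. v y \<in> f t \<and> agree (X - {y}) v t)"
proof
  assume "\<exists>t\<in>T. v y \<in> f t \<and> agree (X - {y}) v t"
  then obtain t where "t \<in> T" "v y \<in> f t" "agree (X - {y}) v t" by blast
  then show "\<exists>t\<in>supplement T y f. agree (insert y X) v t"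
    by (intro bexI[of _ "t(y \<mapsto> v y)"]) (auto simp: agree_def supplement_def)
qed (fastforce simp: agree_def supplement_def)

section \<open>Semantics of the translation\<close>

text \<open>Precedence of the first-order clause is built into the equations of every connective,
  here and in the translation, so the induction can dispose of all first-order formulas at
  once.\<close>

lemma team_sat_as_fo: "as_fo \<phi> = Some \<alpha> \<Longrightarrow> team_sat A T \<phi> \<longleftrightarrow> flat_sat A T \<alpha>"
  by (cases \<phi>) auto

lemma eta_as_fo: "as_fo \<phi> = Some \<alpha> \<Longrightarrow> eta \<phi> xs R = eta_fo xs R \<alpha>"
  by (cases \<phi>) auto

lemma fv_as_fo: "as_fo \<phi> = Some \<alpha> \<Longrightarrow> fv_fo \<alpha> = fv_tf \<phi>"
  by (induction \<phi> arbitrary: \<alpha>) (auto split: option.splits)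

text \<open>The guard \<open>papp R xs\<close> selects exactly the valuations that agree with some
  team member on \<open>xs\<close>, and such a valuation and member satisfy the same
  \<open>\<alpha>\<close>.\<close>

lemma so_sat_eta_fo:
  assumes "univ A \<noteq> {}" "fv_fo \<alpha> \<subseteq> set xs"
    and "team_in (univ A) (set xs) T" "represents (univ A) xs T (\<sigma> R)"
  shows "so_sat A s \<sigma> (eta_fo xs R \<alpha>) \<longleftrightarrow> flat_sat A T \<alpha>"
proof -
  have sat: "sat A (updv s xs v) \<alpha> \<longleftrightarrow> sat A t \<alpha>" if "agree (set xs) v t" for v t
    by (rule sat_cong) (use that assms(2) in \<open>auto simp: agree_def\<close>)
  have "so_sat A s \<sigma> (eta_fo xs R \<alpha>) \<longleftrightarrow>
      (\<forall>v. range v \<subseteq> univ A \<longrightarrow> (\<exists>t\<in>T. agree (set xs) v t) \<longrightarrow> sat A (updv s xs v) \<alpha>)"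
    using assms(4) by (simp add: eta_fo_def so_sat_SAlls[OF assms(1)] so_sat_SImp so_sat_papp_updv
        so_sat_so_of_fo_Sym represents_def)
  also have "\<dots> \<longleftrightarrow> flat_sat A T \<alpha>"
    unfolding flat_sat_def using sat total_extension[OF assms(3,1)] by metis
  finally show ?thesis .
qed

text \<open>Since \<open>zs\<close> is distinct, the defining equivalence pins the quantified
  relation down to \<open>team_val A ts T\<close> on all tuples. The dependency is then evaluated on
  that very relation.\<close>

lemma so_sat_eta_Dep:
  fixes A :: "('a, 'f, 'p) struct"
  assumes A: "is_structure \<tau> A" and d: "is_dependency d"
    and ts: "length ts = fst d" "list_all (wf_tm \<tau>) ts" "\<Union> (set (map fv_tm ts)) \<subseteq> set xs"
    and T: "team_in (univ A) (set xs) T" "represents (univ A) xs T (\<sigma> R)"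
  shows "so_sat A s \<sigma> (eta (Dep d ts) xs R) \<longleftrightarrow> dep_holds (univ A) (team_val A ts T) d"
proof -
  have ne: "univ A \<noteq> {}"
    using A by (simp add: is_structure_def)
  define zs where "zs = fresh_vars (fst d) xs"
  have zs: "length zs = fst d" "distinct zs" "set zs \<inter> set xs = {}"
    using fresh_vars by (auto simp: zs_def)
  define S where "S = fresh1 R (fst d)"
  have S: "S \<noteq> R" "R \<noteq> S" "pvar_arity S = fst d"
    by (simp_all add: S_def)
  define \<Psi> :: "('f, 'p) so" where
    "\<Psi> = SExs xs (foldl SAnd (papp R xs) (map2 (\<lambda>t z. SEq t (Var z)) ts zs))"
  have inner: "so_sat A (updv s zs v) \<sigma>' \<Psi> \<longleftrightarrow> map v zs \<in> team_val A ts T"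
    if \<sigma>': "\<sigma>' R = \<sigma> R" for v \<sigma>'
  proof -
    \<comment> \<open>The inner block overrides only \<open>xs\<close>, which is disjoint from
      \<open>zs\<close>, so the values of \<open>zs\<close> set by the outer block survive.\<close>
    let ?s = "\<lambda>w. updv (updv s zs v) xs w"
    have z: "the (?s w z) = v z" if "z \<in> set zs" for w z
      using that zs(3) by (auto simp: override_on_def)
    have val: "map (val A (?s w)) ts = map (val A t) ts" if "agree (set xs) w t" for w t
      using that ts(3) by (auto simp: agree_def intro!: val_cong)
    have eqs: "(\<forall>\<Theta>\<in>set (map2 (\<lambda>t z. SEq t (Var z)) ts zs). so_sat A (?s w) \<sigma>' \<Theta>) \<longleftrightarrow>
        map (val A (?s w)) ts = map v zs" for w
    proof -
      have "(\<forall>\<Theta>\<in>set (map2 (\<lambda>t z. SEq t (Var z)) ts zs). so_sat A (?s w) \<sigma>' \<Theta>) \<longleftrightarrow>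
          (\<forall>i<length zs. val A (?s w) (ts ! i) = the (?s w (zs ! i)))"
        using ts(1) zs(1) by (auto simp: set_zip)
      also have "\<dots> \<longleftrightarrow> map (val A (?s w)) ts = map v zs"
        using ts(1) zs(1) z by (auto simp: list_eq_iff_nth_eq)
      finally show ?thesis .
    qed
    have rep: "map w xs \<in> \<sigma>' R \<longleftrightarrow> (\<exists>t\<in>T. agree (set xs) w t)" if "range w \<subseteq> univ A" for w
      using T(2) that \<sigma>' by (simp add: represents_def)
    have "so_sat A (updv s zs v) \<sigma>' \<Psi> \<longleftrightarrow> (\<exists>w. range w \<subseteq> univ A \<and>
        (\<exists>t\<in>T. agree (set xs) w t) \<and> map (val A (?s w)) ts = map v zs)"
      unfolding \<Psi>_def so_sat_SExs[OF ne] so_sat_foldl_SAnd eqs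
      by (simp add: so_sat_papp_updv rep cong: conj_cong)
    \<comment> \<open>The values of \<open>ts\<close> under \<open>w\<close> are those under the
      member that \<open>w\<close> agrees with, and every member extends to such a
      \<open>w\<close>.\<close>
    also have "\<dots> \<longleftrightarrow> (\<exists>t\<in>T. map (val A t) ts = map v zs)"
      using val total_extension[OF T(1) ne] by metis
    also have "\<dots> \<longleftrightarrow> map v zs \<in> team_val A ts T"
      by (simp add: team_val_def) metis
    finally show ?thesis .
  qed
  \<comment> \<open>\<open>SEx2\<close> ranges over sets of tuples from the universe, so the only
    candidate has to be one of them.\<close>
  have sub: "team_val A ts T \<subseteq> tuples (fst d) (univ A)"
  proof -
    have "val A t u \<in> univ A" if "t \<in> T" "u \<in> set ts" for t u
      by (rule val_in_univ[OF A])
        (use that ts T(1) in \<open>auto simp: list_all_iff team_in_def\<close>)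
    then show ?thesis
      using ts(1) by (auto simp: team_val_def tuples_def)
  qed
  have ext: "(\<forall>v. range v \<subseteq> univ A \<longrightarrow> (map v zs \<in> Q \<longleftrightarrow> map v zs \<in> team_val A ts T)) \<longleftrightarrow>
      Q = team_val A ts T" if "Q \<subseteq> tuples (fst d) (univ A)" for Q
  proof
    assume *: "\<forall>v. range v \<subseteq> univ A \<longrightarrow> (map v zs \<in> Q \<longleftrightarrow> map v zs \<in> team_val A ts T)"
    have "as \<in> Q \<longleftrightarrow> as \<in> team_val A ts T" if as: "as \<in> tuples (fst d) (univ A)" for as
    proof -
      obtain v where "range v \<subseteq> univ A" "map v zs = as"
        using distinct_surj_map[OF zs(2), of as "univ A"] as ne zs(1) by (auto simp: tuples_def)
      then show ?thesis
        using * by metis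
    qed
    then show "Q = team_val A ts T"
      using that sub by blast
  qed simp
  have "so_sat A s \<sigma> (eta (Dep d ts) xs R) \<longleftrightarrow> (\<exists>Q\<subseteq>tuples (fst d) (univ A).
      Q = team_val A ts T \<and> so_sat A s (\<sigma>(S := Q)) (so_of_fo (\<lambda>_. PVar S) (snd d)))"
    using ext
    by (auto simp: Let_def zs_def[symmetric] S_def[symmetric] \<Psi>_def[symmetric]
        so_sat_SAlls[OF ne] so_sat_SIff so_sat_papp_updv inner S)
  also have "\<dots> \<longleftrightarrow> dep_holds (univ A) (team_val A ts T) d"
  proof -
    \<comment> \<open>\<open>snd d\<close> is a sentence, so \<open>s\<close> can be exchanged for
      \<open>Map.empty\<close>.\<close>
    have "so_sat A s \<sigma>' (so_of_fo (\<lambda>_. PVar S) (snd d)) \<longleftrightarrow> dep_holds (univ A) (\<sigma>' S) d" for \<sigma>'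
      unfolding dep_holds_def
      by (rule so_sat_so_of_fo_PVar) (use d in \<open>auto simp: is_dependency_def\<close>)
    then show ?thesis
      using sub by simp
  qed
  finally show ?thesis .
qed

section \<open>The clauses for quantifiers and disjunction\<close>

text \<open>\<open>P\<close> and \<open>P'\<close> stand for the two sides of the induction
  hypothesis, as properties of a team and of a relation. The equivalence on the right says that both
  relations leave the same trace once \<open>y\<close> is quantified out, which is what nonempty
  choices produce.\<close>

lemma ex_supplement_iff:
  assumes U: "U \<noteq> {}" and T: "team_in U (set xs) T" "represents U xs T Q"
    and P: "\<And>T' Q'. team_in U (set (adjoin xs y)) T' \<Longrightarrow> represents U (adjoin xs y) T' Q' \<Longrightarrow>
        P T' \<longleftrightarrow> P' Q'"
  shows "(\<exists>f. (\<forall>t\<in>T. f t \<in> Pow U - {{}}) \<and> P (supplement T y f)) \<longleftrightarrow>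
    (\<exists>Q'\<subseteq>tuples (length (adjoin xs y)) U.
      (\<forall>v. range v \<subseteq> U \<longrightarrow>
        ((\<exists>a\<in>U. map (v(y := a)) xs \<in> Q) \<longleftrightarrow> (\<exists>a\<in>U. map (v(y := a)) (adjoin xs y) \<in> Q'))) \<and> P' Q')"
    (is "?L \<longleftrightarrow> ?R")
proof
  let ?xy = "adjoin xs y"
  note ex = represents_exI[OF T(1) U T(2)]
  show ?R if ?L
  proof -
    from that obtain f where f: "\<forall>t\<in>T. f t \<in> Pow U - {{}}" and Pf: "P (supplement T y f)"
      by blast
    let ?T' = "supplement T y f"
    define Q' where "Q' = (\<lambda>t. map (\<lambda>x. the (t x)) ?xy) ` ?T'"
    have T': "team_in U (set ?xy) ?T'"
      unfolding set_adjoin by (rule team_in_supplement) (use T(1) f in auto)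
    have rep: "represents U ?xy ?T' Q'"
      unfolding Q'_def by (rule represents_image)
    have "Q' \<subseteq> tuples (length ?xy) U"
      unfolding Q'_def by (rule image_tuples[OF T'])
    moreover have "P' Q'"
      using P[OF T' rep] Pf by simp
    moreover have "(\<exists>a\<in>U. map (v(y := a)) xs \<in> Q) \<longleftrightarrow> (\<exists>a\<in>U. map (v(y := a)) ?xy \<in> Q')"
      if "range v \<subseteq> U" for v
      unfolding ex[OF that] represents_exI[OF T' U rep that] set_adjoin
      by (rule supplement_agree[symmetric]) (use f in blast)
    ultimately show ?R by blast
  qed
  show ?L if ?R
  proof -
    from that obtain Q' where Q': "P' Q'" and eq: "\<And>v. range v \<subseteq> U \<Longrightarrow>
        (\<exists>a\<in>U. map (v(y := a)) xs \<in> Q) \<longleftrightarrow> (\<exists>a\<in>U. map (v(y := a)) ?xy \<in> Q')"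
      by blast
    define f where "f t = {a \<in> U. map (\<lambda>x. the ((t(y \<mapsto> a)) x)) ?xy \<in> Q'}" for t
    \<comment> \<open>The choice set of \<open>t\<close> depends only on the values of
      \<open>t\<close> on \<open>xs\<close> other than at \<open>y\<close>, so it can be computed
      from any \<open>v\<close> that agrees with \<open>t\<close> there.\<close>
    have mem: "a \<in> f t \<longleftrightarrow> a \<in> U \<and> map (v(y := a)) ?xy \<in> Q'"
      if "agree (set xs - {y}) v t" for a t v
    proof -
      have "map (\<lambda>x. the ((t(y \<mapsto> a)) x)) ?xy = map (v(y := a)) ?xy"
        using that by (auto simp: agree_def set_adjoin)
      then show ?thesis
        by (simp only: f_def mem_Collect_eq)
    qed
    have f: "f t \<in> Pow U - {{}}" if t: "t \<in> T" for t
    proof -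
      obtain v where v: "range v \<subseteq> U" "agree (set xs) v t"
        using total_extension[OF T(1) U t] .
      then have ag: "agree (set xs - {y}) v t"
        by (auto simp: agree_def)
      \<comment> \<open>The member \<open>t\<close> itself agrees with \<open>v\<close> off
        \<open>y\<close>, so the equivalence supplies an element of its choice set.\<close>
      then have "\<exists>a\<in>U. map (v(y := a)) ?xy \<in> Q'"
        using eq[OF v(1)] ex[OF v(1)] that by blast
      then show ?thesis
        using mem[OF ag] by (auto simp: f_def)
    qed
    have "team_in U (set ?xy) (supplement T y f)"
      unfolding set_adjoin by (rule team_in_supplement) (use T(1) f in auto)
    moreover have "represents U ?xy (supplement T y f) Q'"
      unfolding represents_def
    proof (intro allI impI)
      fix v :: "nat \<Rightarrow> 'a" assume v: "range v \<subseteq> U"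
      have "(\<exists>t\<in>supplement T y f. agree (set ?xy) v t) \<longleftrightarrow>
          (\<exists>t\<in>T. v y \<in> f t \<and> agree (set xs - {y}) v t)"
        unfolding set_adjoin by (rule supplement_agree_insert)
      \<comment> \<open>By \<open>mem\<close> the condition on \<open>v y\<close> no longer depends
        on \<open>t\<close> and leaves the quantifier.\<close>
      also have "\<dots> \<longleftrightarrow> (\<exists>t\<in>T. agree (set xs - {y}) v t) \<and> map v ?xy \<in> Q'"
        using mem[of v _ "v y"] v by (metis fun_upd_triv range_subsetD)
      \<comment> \<open>As \<open>v = v(y := v y)\<close>, a tuple in \<open>Q'\<close> is its own
        witness for the existential, and the equivalence yields the member.\<close>
      also have "\<dots> \<longleftrightarrow> map v ?xy \<in> Q'"
        using eq[OF v] ex[OF v, of y] v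
        by (metis fun_upd_triv range_subsetD)
      finally show "map v ?xy \<in> Q' \<longleftrightarrow> (\<exists>t\<in>supplement T y f. agree (set ?xy) v t)" by simp
    qed
    ultimately have "P (supplement T y f)"
      using P Q' by blast
    then show ?L
      using f by blast
  qed
qed

text \<open>The equivalence keeps out of \<open>Q'\<close> the tuples that come from no team member,
  and the last conjunct forces in all values at \<open>y\<close>. Together they make
  \<open>Q'\<close> represent the full supplement.\<close>

lemma all_supplement_iff:
  assumes U: "U \<noteq> {}" and T: "team_in U (set xs) T" "represents U xs T Q"
    and P: "\<And>T' Q'. team_in U (set (adjoin xs y)) T' \<Longrightarrow> represents U (adjoin xs y) T' Q' \<Longrightarrow>
        P T' \<longleftrightarrow> P' Q'"
  shows "P (supplement T y (\<lambda>_. U)) \<longleftrightarrow>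
    (\<exists>Q'\<subseteq>tuples (length (adjoin xs y)) U.
      (\<forall>v. range v \<subseteq> U \<longrightarrow>
        ((\<exists>a\<in>U. map (v(y := a)) xs \<in> Q) \<longleftrightarrow> (\<exists>a\<in>U. map (v(y := a)) (adjoin xs y) \<in> Q'))) \<and>
      P' Q' \<and>
      (\<forall>v. range v \<subseteq> U \<longrightarrow> map v xs \<in> Q \<longrightarrow> (\<forall>a\<in>U. map (v(y := a)) (adjoin xs y) \<in> Q')))"
    (is "?L \<longleftrightarrow> ?R")
proof
  let ?xy = "adjoin xs y" and ?T' = "supplement T y (\<lambda>_. U)"
  note ex = represents_exI[OF T(1) U T(2)]
  have T': "team_in U (set ?xy) ?T'"
    unfolding set_adjoin by (rule team_in_supplement) (use T(1) in auto)
  \<comment> \<open>Every \<open>v y\<close> lies in \<open>U\<close>, so the condition from the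
    choice set disappears.\<close>
  have ag: "(\<exists>t\<in>?T'. agree (set ?xy) v t) \<longleftrightarrow> (\<exists>t\<in>T. agree (set xs - {y}) v t)"
    if "range v \<subseteq> U" for v
    unfolding set_adjoin supplement_agree_insert using that by blast
  show ?R if ?L
  proof -
    define Q' where "Q' = (\<lambda>t. map (\<lambda>x. the (t x)) ?xy) ` ?T'"
    have rep: "represents U ?xy ?T' Q'"
      unfolding Q'_def by (rule represents_image)
    have "Q' \<subseteq> tuples (length ?xy) U"
      unfolding Q'_def by (rule image_tuples[OF T'])
    moreover have "P' Q'"
      using P[OF T' rep] that by simp
    moreover have "(\<exists>a\<in>U. map (v(y := a)) xs \<in> Q) \<longleftrightarrow> (\<exists>a\<in>U. map (v(y := a)) ?xy \<in> Q')"
      if "range v \<subseteq> U" for v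
      unfolding ex[OF that] represents_exI[OF T' U rep that] set_adjoin
      by (rule supplement_agree[symmetric]) (use U in blast)
    moreover have "map (v(y := a)) ?xy \<in> Q'" if v: "range v \<subseteq> U" "map v xs \<in> Q" "a \<in> U" for v a
    proof -
      have r: "range (v(y := a)) \<subseteq> U"
        using v(1,3) by auto
      obtain t where "t \<in> T" "agree (set xs) v t"
        using v(1,2) T(2) by (auto simp: represents_def)
      then have "\<exists>t\<in>T. agree (set xs - {y}) (v(y := a)) t"
        by (auto simp: agree_def)
      then show ?thesis
        using rep r ag[OF r] unfolding represents_def by blast
    qed
    ultimately show ?R by (intro exI[of _ Q']) simp
  qed
  show ?L if ?R
  proof -
    from that obtain Q' where Q': "P' Q'" and eq: "\<And>v. range v \<subseteq> U \<Longrightarrow>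
        (\<exists>a\<in>U. map (v(y := a)) xs \<in> Q) \<longleftrightarrow> (\<exists>a\<in>U. map (v(y := a)) ?xy \<in> Q')"
      and all: "\<And>v a. range v \<subseteq> U \<Longrightarrow> map v xs \<in> Q \<Longrightarrow> a \<in> U \<Longrightarrow> map (v(y := a)) ?xy \<in> Q'"
      by blast
    have "represents U ?xy ?T' Q'"
      unfolding represents_def
    proof (intro allI impI)
      fix v :: "nat \<Rightarrow> 'a" assume v: "range v \<subseteq> U"
      have "map v ?xy \<in> Q' \<longleftrightarrow> (\<exists>a\<in>U. map (v(y := a)) xs \<in> Q)"
      proof
        assume "map v ?xy \<in> Q'"
        then show "\<exists>a\<in>U. map (v(y := a)) xs \<in> Q"
          using eq[OF v] v by (metis fun_upd_triv range_subsetD)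
      next
        assume "\<exists>a\<in>U. map (v(y := a)) xs \<in> Q"
        then obtain a where a: "a \<in> U" "map (v(y := a)) xs \<in> Q" by blast
        \<comment> \<open>The last conjunct is applied to \<open>v(y := a)\<close>, whose tuple is
          in \<open>Q\<close>; resetting \<open>y\<close> to \<open>v y\<close> then restores
          \<open>v\<close>.\<close>
        have "range (v(y := a)) \<subseteq> U"
          using v a(1) by auto
        from all[OF this a(2), of "v y"] show "map v ?xy \<in> Q'"
          using v by (simp add: range_subsetD)
      qed
      then show "map v ?xy \<in> Q' \<longleftrightarrow> (\<exists>t\<in>?T'. agree (set ?xy) v t)"
        unfolding ex[OF v] ag[OF v] .
    qed
    then show ?L
      using P[OF T'] Q' by blast
  qed
qed

text \<open>Either disjunct is evaluated with both new predicate variables interpreted, so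
  \<open>P1'\<close> and \<open>P2'\<close> take both relations; the assumptions leave the other
  relation arbitrary.\<close>

lemma or_split_iff:
  assumes U: "U \<noteq> {}" and T: "team_in U (set xs) T" "represents U xs T Q"
    and P: "\<And>T' Q' Q2. team_in U (set xs) T' \<Longrightarrow> represents U xs T' Q' \<Longrightarrow> P1 T' \<longleftrightarrow> P1' Q' Q2"
      "\<And>T' Q1 Q'. team_in U (set xs) T' \<Longrightarrow> represents U xs T' Q' \<Longrightarrow> P2 T' \<longleftrightarrow> P2' Q1 Q'"
  shows "(\<exists>T1 T2. T1 \<subseteq> T \<and> T2 \<subseteq> T \<and> T = T1 \<union> T2 \<and> P1 T1 \<and> P2 T2) \<longleftrightarrow>
    (\<exists>Q1\<subseteq>tuples (length xs) U. \<exists>Q2\<subseteq>tuples (length xs) U.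
      (\<forall>v. range v \<subseteq> U \<longrightarrow> (map v xs \<in> Q \<longleftrightarrow> map v xs \<in> Q1 \<or> map v xs \<in> Q2)) \<and>
      P1' Q1 Q2 \<and> P2' Q1 Q2)" (is "?L \<longleftrightarrow> ?R")
proof
  show ?R if ?L
  proof -
    from that obtain T1 T2 where T12: "T = T1 \<union> T2" "P1 T1" "P2 T2"
      by blast
    then have in12: "team_in U (set xs) T1" "team_in U (set xs) T2"
      using T(1) by (auto simp: team_in_def)
    define q where "q T' = (\<lambda>t. map (\<lambda>x. the (t x)) xs) ` T'" for T' :: "'a team"
    have rep: "represents U xs T' (q T')" for T'
      unfolding q_def by (rule represents_image)
    have "q T' \<subseteq> tuples (length xs) U" if "team_in U (set xs) T'" for T'
      unfolding q_def by (rule image_tuples[OF that])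
    moreover have "P1' (q T1) (q T2)" "P2' (q T1) (q T2)"
      using P rep in12 T12 by blast+
    moreover have "map v xs \<in> Q \<longleftrightarrow> map v xs \<in> q T1 \<or> map v xs \<in> q T2" if "range v \<subseteq> U" for v
      using that rep[of T1] rep[of T2] T(2) T12(1) unfolding represents_def by blast
    ultimately show ?R
      using in12 by blast
  qed
  show ?L if ?R
  proof -
    from that obtain Q1 Q2 where Q12: "P1' Q1 Q2" "P2' Q1 Q2"
      and eq: "\<And>v. range v \<subseteq> U \<Longrightarrow> map v xs \<in> Q \<longleftrightarrow> map v xs \<in> Q1 \<or> map v xs \<in> Q2"
      by blast
    \<comment> \<open>All members projecting into \<open>Q'\<close> are taken; the two parts may
      overlap, as a splitting permits.\<close>
    define p where "p Q' = {t \<in> T. map (\<lambda>x. the (t x)) xs \<in> Q'}" for Q'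
    have p: "team_in U (set xs) (p Q')" for Q'
      using T(1) by (auto simp: p_def team_in_def)
    \<comment> \<open>The assumption excludes valuations whose tuple is in \<open>Q'\<close>
      although no member of \<open>T\<close> agrees with them.\<close>
    have rep: "represents U xs (p Q') Q'"
      if "\<And>v. range v \<subseteq> U \<Longrightarrow> map v xs \<in> Q' \<Longrightarrow> map v xs \<in> Q" for Q'
      unfolding represents_def
    proof (intro allI impI)
      fix v :: "nat \<Rightarrow> 'a" assume v: "range v \<subseteq> U"
      have "(\<exists>t\<in>p Q'. agree (set xs) v t) \<longleftrightarrow> (\<exists>t\<in>T. agree (set xs) v t) \<and> map v xs \<in> Q'"
        unfolding p_def agree_map by (metis (mono_tags, lifting) mem_Collect_eq)
      then show "map v xs \<in> Q' \<longleftrightarrow> (\<exists>t\<in>p Q'. agree (set xs) v t)"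
        using that[OF v] T(2) v unfolding represents_def by blast
    qed
    have "T \<subseteq> p Q1 \<union> p Q2"
    proof
      fix t assume t: "t \<in> T"
      obtain v where v: "range v \<subseteq> U" "agree (set xs) v t"
        using total_extension[OF T(1) U t] .
      then have "map v xs \<in> Q"
        using T(2) t unfolding represents_def by blast
      then show "t \<in> p Q1 \<union> p Q2"
        using eq[OF v(1)] v(2) t unfolding agree_map p_def by auto
    qed
    moreover have "represents U xs (p Q1) Q1" "represents U xs (p Q2) Q2"
      by (rule rep, simp add: eq)+
    then have "P1 (p Q1)" "P2 (p Q2)"
      using P(1)[OF p] P(2)[OF p] Q12 by simp_all
    moreover have "p Q1 \<subseteq> T" "p Q2 \<subseteq> T"
      by (auto simp: p_def)
    ultimately show ?L by blast
  qed
qed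

section \<open>Induction on the formula\<close>

text \<open>\<open>\<sigma>\<close> is constrained at \<open>R\<close> only and \<open>s\<close> not
  at all, so bindings left by enclosing quantifiers cannot interfere.\<close>

lemma so_sat_eta:
  fixes A :: "('a, 'f, 'p) struct"
  assumes "\<forall>d\<in>D. is_dependency d" "is_structure \<tau> A" "wf_tf \<tau> D \<phi>" "fv_tf \<phi> \<subseteq> set xs"
    and "team_in (univ A) (set xs) T" "represents (univ A) xs T (\<sigma> R)"
  shows "team_sat A T \<phi> \<longleftrightarrow> so_sat A s \<sigma> (eta \<phi> xs R)"
  using assms(3-)
proof (induction \<phi> arbitrary: xs T \<sigma> R s)
  have ne: "univ A \<noteq> {}"
    using assms(2) by (simp add: is_structure_def)
  \<comment> \<open>This settles every formula recognised by \<open>as_fo\<close>; the compound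
    cases are then left with \<open>None\<close>.\<close>
  have fo: "team_sat A T \<phi> \<longleftrightarrow> so_sat A s \<sigma> (eta \<phi> xs R)"
    if "as_fo \<phi> = Some \<alpha>" "fv_tf \<phi> \<subseteq> set xs" "team_in (univ A) (set xs) T"
      "represents (univ A) xs T (\<sigma> R)" for \<phi> :: "('f, 'p) tf" and \<alpha> xs T \<sigma> R s
    using that so_sat_eta_fo[OF ne] team_sat_as_fo[OF that(1)] eta_as_fo[OF that(1)]
      fv_as_fo[OF that(1)]
    by metis
  note eta_simps = Let_def so_sat_SAlls[OF ne] so_sat_SIff so_sat_SImp so_sat_papp_updv
    so_sat_papp_updv_upd set_adjoin subset_insertI
  {
    case (FO \<alpha>)
    then show ?case
      by (intro fo[where \<alpha> = \<alpha>]) auto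
  next
    case (Dep d ts)
    then show ?case
      using so_sat_eta_Dep[OF assms(2), of d ts xs T \<sigma> R s] assms(1) by auto
  next
    case (TNeg \<psi>)
    then show ?case
      by simp
  next
    case (TAnd \<psi> \<theta>)
    show ?case
    proof (cases "as_fo (TAnd \<psi> \<theta>)")
      case None
      have "team_sat A T \<psi> \<longleftrightarrow> so_sat A s \<sigma> (eta \<psi> xs R)"
        "team_sat A T \<theta> \<longleftrightarrow> so_sat A s \<sigma> (eta \<theta> xs R)"
        by (rule TAnd.IH; use TAnd.prems in simp)+
      then show ?thesis
        using None by (simp del: as_fo.simps)
    qed (use fo TAnd.prems in blast)
  next
    case (TOr \<psi> \<theta>)
    show ?case
    proof (cases "as_fo (TOr \<psi> \<theta>)")
      case None
      let ?S = "fresh1 R (length xs)" and ?U = "fresh2 R (length xs)"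
      \<comment> \<open>Inside \<open>eta \<psi> xs ?S\<close> the next fresh predicate variable may
        be \<open>?U\<close> itself. The shadowing is harmless, since the hypothesis involves only
        the value at \<open>?S\<close>; hence \<open>Q2\<close> stays arbitrary.\<close>
      have IH: "team_sat A T' \<psi> \<longleftrightarrow> so_sat A s (\<sigma>(?S := Q', ?U := Q2)) (eta \<psi> xs ?S)"
        "team_sat A T' \<theta> \<longleftrightarrow> so_sat A s (\<sigma>(?S := Q1, ?U := Q')) (eta \<theta> xs ?U)"
        if "team_in (univ A) (set xs) T'" "represents (univ A) xs T' Q'" for T' Q' Q1 Q2
        by (rule TOr.IH; use TOr.prems that in simp)+
      have "team_sat A T (TOr \<psi> \<theta>) \<longleftrightarrow>
          (\<exists>S U. S \<subseteq> T \<and> U \<subseteq> T \<and> T = S \<union> U \<and> team_sat A S \<psi> \<and> team_sat A U \<theta>)"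
        using None by (simp del: as_fo.simps)
      also note or_split_iff[where ?P1.0 = "\<lambda>T'. team_sat A T' \<psi>" and ?P2.0 = "\<lambda>T'. team_sat A T' \<theta>"
          and P1' = "\<lambda>Q1 Q2. so_sat A s (\<sigma>(?S := Q1, ?U := Q2)) (eta \<psi> xs ?S)"
          and P2' = "\<lambda>Q1 Q2. so_sat A s (\<sigma>(?S := Q1, ?U := Q2)) (eta \<theta> xs ?U)",
          OF ne TOr.prems(3,4) IH]
      finally show ?thesis
        using None by (simp add: eta_simps del: as_fo.simps)
    qed (use fo TOr.prems in blast)
  next
    case (TEx y \<psi>)
    show ?case
    proof (cases "as_fo (TEx y \<psi>)")
      case None
      let ?xy = "adjoin xs y"
      let ?S = "fresh1 R (length ?xy)"
      have IH: "team_sat A T' \<psi> \<longleftrightarrow> so_sat A s (\<sigma>(?S := Q')) (eta \<psi> ?xy ?S)"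
        if "team_in (univ A) (set ?xy) T'" "represents (univ A) ?xy T' Q'" for T' Q'
        by (rule TEx.IH) (use TEx.prems that in \<open>auto simp: set_adjoin\<close>)
      have "team_sat A T (TEx y \<psi>) \<longleftrightarrow>
          (\<exists>f. (\<forall>t\<in>T. f t \<in> Pow (univ A) - {{}}) \<and> team_sat A (supplement T y f) \<psi>)"
        using None by (simp del: as_fo.simps)
      also note ex_supplement_iff[where P = "\<lambda>T'. team_sat A T' \<psi>"
          and P' = "\<lambda>Q'. so_sat A s (\<sigma>(?S := Q')) (eta \<psi> ?xy ?S)", OF ne TEx.prems(3,4) IH]
      finally show ?thesis
        using None by (simp add: eta_simps del: as_fo.simps)
    qed (use fo TEx.prems in blast)
  next
    case (TAll y \<psi>)
    show ?case
    proof (cases "as_fo (TAll y \<psi>)")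
      case None
      let ?xy = "adjoin xs y"
      let ?S = "fresh1 R (length ?xy)"
      have IH: "team_sat A T' \<psi> \<longleftrightarrow> so_sat A s (\<sigma>(?S := Q')) (eta \<psi> ?xy ?S)"
        if "team_in (univ A) (set ?xy) T'" "represents (univ A) ?xy T' Q'" for T' Q'
        by (rule TAll.IH) (use TAll.prems that in \<open>auto simp: set_adjoin\<close>)
      have "team_sat A T (TAll y \<psi>) \<longleftrightarrow> team_sat A (supplement T y (\<lambda>_. univ A)) \<psi>"
        using None by (simp del: as_fo.simps)
      also note all_supplement_iff[where P = "\<lambda>T'. team_sat A T' \<psi>"
          and P' = "\<lambda>Q'. so_sat A s (\<sigma>(?S := Q')) (eta \<psi> ?xy ?S)", OF ne TAll.prems(3,4) IH]
      finally show ?thesis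
        using None by (simp add: eta_simps del: as_fo.simps)
    qed (use fo TAll.prems in blast)
  }
qed

theorem theorem3p1:
  fixes \<tau> :: "('f, 'p) vocabulary"
    and A :: "('a, 'f, 'p) struct"
    and D :: "'f dependency set"
    and \<phi> :: "('f, 'p) tf"
    and xs :: "nat list"
    and Y :: "nat set"
    and T :: "'a team"
    and R :: pvar
  assumes "\<forall>d\<in>D. is_dependency d"
    and "wf_tf \<tau> D \<phi>"
    and "fv_tf \<phi> \<subseteq> set xs"
    and "is_structure \<tau> A"
    and "finite (univ A)"
    and "is_team A Y T"
    and "finite T"
    and "set xs \<subseteq> Y"
    and "pvar_arity R = length xs"
  shows "team_sat A T \<phi> \<longleftrightarrow> so_models A (eta \<phi> xs R) R (team_val A (map Var xs) T)"
proof -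
  \<comment> \<open>As \<open>xs\<close> lies within the domain \<open>Y\<close>, each value read
    through \<open>the\<close> is a genuine one from the range.\<close>
  have team: "team_in (univ A) (set xs) T"
    unfolding team_in_def
  proof (intro ballI)
    fix t x assume "t \<in> T" "x \<in> set xs"
    then have "x \<in> dom t" "ran t \<subseteq> univ A"
      using assms(6,8) by (auto simp: is_team_def)
    then show "the (t x) \<in> univ A"
      by (auto intro: ranI)
  qed
  show ?thesis
    unfolding so_models_def
    \<comment> \<open>The projection of \<open>T\<close> is the canonical relation representing it,
      and the environment fixed by \<open>so_models\<close> is an instance of the arbitrary
      \<open>s\<close> and \<open>\<sigma>\<close>.\<close>
    by (rule so_sat_eta[OF assms(1,4,2,3) team]) (simp add: team_val_Var represents_image)
qed

end
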